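(* Let $k$ be a positive integer and let $G$ be the $(6k-1)\times(6k-1)$ grid graph. Then the answer to the Most Clicks Problem on $G$ is at most $26k^2 - 12k + 1$. Moreover, if $d(6k-1) = 2$, the answer to the Most Clicks Problem on $G$ is exactly $26k^2 - 12k + 1$.
   Context: The $m\times m$ grid graph has the cells of an $m\times m$ array as vertices, two being adjacent when they share a side. For a graph $G=(V,E)$ and $v\in V$ let $N[v]$ be the closed neighborhood of $v$, and define $\Phi_G(S) = \{v \in V : \lvert N[v]\cap S\rvert \text{ odd}\}$ for $S\subseteq V$ (the set of lights toggled when each vertex of $S$ is clicked once, clicking a vertex toggling it and its neighbors). An initial configuration $C\subseteq V$ (lights that are on) is solvable if $C = \Phi_G(S)$ for some $S$, called a solution; its minimum number of clicks is $\min\{\lvert S\rvert : \Phi_G(S) = C\}$. The Most Clicks Problem asks for the maximum, over all solvable initial configurations $C$, of the minimum number of clicks needed to solve $C$. $d(m)$ denotes $\dim_{\mathbb{F}_2}\ker \Phi_G$ for $G$ the $m\times m$ grid graph. *)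

theory Defs
  imports Complex_Main "HOL-Library.Z2" "HOL-Library.Function_Algebras"
begin

type_synonym 'v graph = "'v set \<times> 'v set set"

abbreviation verts :: "'v graph \<Rightarrow> 'v set" where
  "verts G \<equiv> fst G"

abbreviation edges :: "'v graph \<Rightarrow> 'v set set" where
  "edges G \<equiv> snd G"

definition closed_nbhd :: "'v graph \<Rightarrow> 'v \<Rightarrow> 'v set" where
  "closed_nbhd G v = insert v {w \<in> verts G. {v, w} \<in> edges G}"

definition toggled :: "'v graph \<Rightarrow> 'v set \<Rightarrow> 'v set" where
  "toggled G S = {v \<in> verts G. odd (card (closed_nbhd G v \<inter> S))}"

definition solutions :: "'v graph \<Rightarrow> 'v set \<Rightarrow> 'v set set" where
  "solutions G C = {S. S \<subseteq> verts G \<and> toggled G S = C}"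

definition solvable :: "'v graph \<Rightarrow> 'v set \<Rightarrow> bool" where
  "solvable G C \<longleftrightarrow> solutions G C \<noteq> {}"

text \<open>For finite graphs the sets under \<open>Min\<close> (with \<open>C\<close> solvable) and \<open>Max\<close>
  are finite and nonempty; the empty configuration is always solvable.\<close>

definition min_clicks :: "'v graph \<Rightarrow> 'v set \<Rightarrow> nat" where
  "min_clicks G C = Min (card ` solutions G C)"

definition most_clicks :: "'v graph \<Rightarrow> nat" where
  "most_clicks G = Max (min_clicks G ` {C. C \<subseteq> verts G \<and> solvable G C})"

definition grid_graph :: "nat \<Rightarrow> (nat \<times> nat) graph" where
  "grid_graph m =
    (let V = {..<m} \<times> {..<m} in
      (V, {{(i, j), (i', j')} | i j i' j'. (i, j) \<in> V \<and> (i', j') \<in> V \<and>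
             (i' = i \<and> j' = Suc j \<or> i' = Suc i \<and> j' = j)}))"

text \<open>Subsets of the vertex set with symmetric difference form a vector space over the
  two-element field \<^typ>\<open>bit\<close>; a subset is identified with its indicator function.\<close>

definition scale_F2 :: "bit \<Rightarrow> ('v \<Rightarrow> bit) \<Rightarrow> 'v \<Rightarrow> bit" where
  "scale_F2 c f = (\<lambda>v. c * f v)"

lemma vector_space_F2: "vector_space scale_F2"
  by unfold_locales (auto simp: scale_F2_def fun_eq_iff algebra_simps)

definition indicator_F2 :: "'v set \<Rightarrow> 'v \<Rightarrow> bit" where
  "indicator_F2 S = (\<lambda>v. of_bool (v \<in> S))"

definition kernel_dim :: "'v graph \<Rightarrow> nat" where
  "kernel_dim G = vector_space.dim scale_F2 (indicator_F2 ` {S. S \<subseteq> verts G \<and> toggled G S = {}})"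

definition d_grid :: "nat \<Rightarrow> nat" where
  "d_grid m = kernel_dim (grid_graph m)"

end

theory Submission
  imports Defs
begin

text \<open>Call a click set quiet if it toggles nothing. The solutions of a configuration are the
  translates \<open>S + R\<close> of one solution \<open>S\<close> by the quiet patterns \<open>R\<close>. Quiet patterns form a group,
  so a cell that some quiet pattern contains lies in exactly half of these translates; averaging
  their sizes bounds the most clicks by \<open>|V| - |U| / 2\<close>, where \<open>U\<close> is the union of all
  quiet patterns. The bound is attained by a set that contains all cells outside \<open>U\<close> and half
  of the cells of every quiet pattern.

  On the \<open>(6k - 1) \<times> (6k - 1)\<close> grid with cells numbered from \<open>1\<close>, the pattern
  \<open>P = {(i, j). \<not> 3 dvd i \<and> odd j}\<close> and its transpose \<open>Q\<close> are quiet, and \<open>|P \<union> Q| = 20 k\<^sup>2\<close>.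
  If they span the kernel, such a set is found by halving \<open>P - Q\<close>,
  \<open>Q - P\<close> and \<open>P \<inter> Q\<close>.\<close>

subsection \<open>Symmetric differences\<close>

lemma card_sym_diff:
  assumes "finite A" "finite B"
  shows "card (sym_diff A B) + 2 * card (A \<inter> B) = card A + card B"
proof -
  have "card (sym_diff A B) = card (A - B) + card (B - A)"
    using assms by (intro card_Un_disjoint) auto
  moreover have "card (A - B) + card (A \<inter> B) = card A" "card (B - A) + card (A \<inter> B) = card B"
    using assms card_Int_Diff[of A B] card_Int_Diff[of B A] by (simp_all add: Int_commute)
  ultimately show ?thesis by simp
qed

lemma even_card_sym_diff:
  assumes "finite A" "finite B"
  shows "even (card (sym_diff A B)) \<longleftrightarrow> (even (card A) \<longleftrightarrow> even (card B))"
  using card_sym_diff[OF assms] by presburger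

lemma card_containing_half:
  assumes "finite K" and closed: "\<And>A B. A \<in> K \<Longrightarrow> B \<in> K \<Longrightarrow> sym_diff A B \<in> K"
    and "v \<in> \<Union>K"
  shows "2 * card {R \<in> K. v \<in> R} = card K" and "2 * card {R \<in> K. v \<notin> R} = card K"
proof -
  obtain R\<^sub>0 where R\<^sub>0: "R\<^sub>0 \<in> K" "v \<in> R\<^sub>0" using \<open>v \<in> \<Union>K\<close> by blast
  have involution: "sym_diff R\<^sub>0 (sym_diff R\<^sub>0 R) = R" for R by blast
  have "bij_betw (sym_diff R\<^sub>0) {R \<in> K. v \<in> R} {R \<in> K. v \<notin> R}"
    by (rule bij_betw_byWitness[where f' = "sym_diff R\<^sub>0"]) (use closed R\<^sub>0 involution in auto)
  then have equal_card: "card {R \<in> K. v \<in> R} = card {R \<in> K. v \<notin> R}"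
    by (rule bij_betw_same_card)
  have "K = {R \<in> K. v \<in> R} \<union> {R \<in> K. v \<notin> R}" by blast
  then have "card K = card {R \<in> K. v \<in> R} + card {R \<in> K. v \<notin> R}"
    using \<open>finite K\<close> by (subst card_Un_disjoint[symmetric]) auto
  with equal_card show "2 * card {R \<in> K. v \<in> R} = card K" "2 * card {R \<in> K. v \<notin> R} = card K"
    by simp_all
qed

lemma sum_card_sym_diff:
  assumes "finite S" "finite K" "\<And>R. R \<in> K \<Longrightarrow> finite R"
    and closed: "\<And>A B. A \<in> K \<Longrightarrow> B \<in> K \<Longrightarrow> sym_diff A B \<in> K"
  shows "2 * (\<Sum>R\<in>K. card (sym_diff S R)) = card K * (2 * card (S - \<Union>K) + card (\<Union>K))"
proof -
  let ?V = "S \<union> \<Union>K"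
  have "finite (\<Union>K)" using assms(2,3) by blast
  with \<open>finite S\<close> have fin: "finite (\<Union>K)" "finite ?V" by simp_all
  have "(\<Sum>R\<in>K. card (sym_diff S R)) = (\<Sum>R\<in>K. card {v \<in> ?V. v \<in> sym_diff S R})"
    by (intro sum.cong arg_cong[where f = card]) auto
  also have "\<dots> = (\<Sum>v\<in>?V. card {R \<in> K. v \<in> sym_diff S R})"
    by (rule sum_multicount_gen[OF \<open>finite K\<close> fin(2)]) simp
  finally have "2 * (\<Sum>R\<in>K. card (sym_diff S R))
      = (\<Sum>v\<in>?V. 2 * card {R \<in> K. v \<in> sym_diff S R})"
    by (simp add: sum_distrib_left)
  also have "?V = (S - \<Union>K) \<union> \<Union>K" by blast
  also have "(\<Sum>v\<in>\<dots>. 2 * card {R \<in> K. v \<in> sym_diff S R})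
      = (\<Sum>v\<in>S - \<Union>K. 2 * card {R \<in> K. v \<in> sym_diff S R})
        + (\<Sum>v\<in>\<Union>K. 2 * card {R \<in> K. v \<in> sym_diff S R})"
    by (rule sum.union_disjoint) (use \<open>finite S\<close> fin in auto)
  also have "(\<Sum>v\<in>S - \<Union>K. 2 * card {R \<in> K. v \<in> sym_diff S R}) = (\<Sum>v\<in>S - \<Union>K. 2 * card K)"
  proof (rule sum.cong)
    fix v assume "v \<in> S - \<Union>K"
    then have "{R \<in> K. v \<in> sym_diff S R} = K" by blast
    then show "2 * card {R \<in> K. v \<in> sym_diff S R} = 2 * card K" by simp
  qed simp
  also have "(\<Sum>v\<in>\<Union>K. 2 * card {R \<in> K. v \<in> sym_diff S R}) = (\<Sum>v\<in>\<Union>K. card K)"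
  proof (rule sum.cong)
    fix v assume "v \<in> \<Union>K"
    then show "2 * card {R \<in> K. v \<in> sym_diff S R} = card K"
      using card_containing_half[OF \<open>finite K\<close> closed, of v] by (cases "v \<in> S") simp_all
  qed simp
  finally show ?thesis by (simp add: algebra_simps)
qed

subsection \<open>Bisecting sets\<close>

definition bisects :: "'a set \<Rightarrow> 'a set \<Rightarrow> bool" where
  "bisects S A \<longleftrightarrow> 2 * card (S \<inter> A) = card A"

lemma bisects_empty: "bisects S {}"
  by (simp add: bisects_def)

lemma bisects_Un:
  assumes "finite A" "finite B" "A \<inter> B = {}" "bisects S A" "bisects S B"
  shows "bisects S (A \<union> B)"
proof -
  have "card (S \<inter> (A \<union> B)) = card (S \<inter> A) + card (S \<inter> B)"
    unfolding Int_Un_distrib using assms by (intro card_Un_disjoint) auto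
  moreover have "card (A \<union> B) = card A + card B"
    using assms by (intro card_Un_disjoint)
  ultimately show ?thesis using assms by (simp add: bisects_def)
qed

lemma card_sym_diff_bisects:
  assumes "finite S" "finite A" "bisects S A"
  shows "card (sym_diff S A) = card S"
  using card_sym_diff[OF assms(1,2)] assms(3) by (simp add: bisects_def)

lemma obtain_bisecting_set:
  assumes "finite V" "\<Union>\<A> \<subseteq> V" "pairwise disjnt \<A>"
    and "\<And>A. A \<in> \<A> \<Longrightarrow> even (card A)"
  obtains S where "S \<subseteq> V" "V - \<Union>\<A> \<subseteq> S" "\<And>A. A \<in> \<A> \<Longrightarrow> bisects S A"
proof -
  define half where "half A = (SOME H. H \<subseteq> A \<and> 2 * card H = card A)" for A :: "'a set"
  have half: "half A \<subseteq> A" "2 * card (half A) = card A" if "A \<in> \<A>" for A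
  proof -
    obtain H where "H \<subseteq> A" "card H = card A div 2"
      by (rule obtain_subset_with_card_n[of "card A div 2" A]) simp_all
    then have "H \<subseteq> A \<and> 2 * card H = card A" using assms(4)[OF that] by simp
    then have "half A \<subseteq> A \<and> 2 * card (half A) = card A" unfolding half_def by (rule someI)
    then show "half A \<subseteq> A" "2 * card (half A) = card A" by simp_all
  qed
  define S where "S = V - \<Union>(half ` \<A>)"
  have "bisects S A" if "A \<in> \<A>" for A
  proof -
    have meets_only_own_half: "B = A" if "x \<in> half B" "x \<in> A" "B \<in> \<A>" for x B
      using assms(3) half(1)[OF \<open>B \<in> \<A>\<close>] \<open>A \<in> \<A>\<close> that
      by (auto simp: pairwise_def disjnt_iff)
    have "A \<subseteq> V" using assms(2) \<open>A \<in> \<A>\<close> by blast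
    then have "S \<inter> A = A - half A"
      using \<open>A \<in> \<A>\<close> by (auto simp: S_def dest: meets_only_own_half)
    moreover have "finite A" using assms(1) \<open>A \<subseteq> V\<close> by (rule rev_finite_subset)
    ultimately have "card (S \<inter> A) = card A - card (half A)"
      using half(1)[OF that] by (simp add: card_Diff_subset finite_subset)
    then show ?thesis using half(2)[OF that] by (simp add: bisects_def)
  qed
  moreover have "S \<subseteq> V" "V - \<Union>\<A> \<subseteq> S" using half(1) by (auto simp: S_def)
  ultimately show ?thesis by (rule that[rotated 2])
qed

subsection \<open>Clicking on finite graphs\<close>

definition quiet_patterns :: "'v graph \<Rightarrow> 'v set set" where
  "quiet_patterns G = {R. R \<subseteq> verts G \<and> toggled G R = {}}"

lemma toggled_sym_diff:
  assumes "finite S" "finite T"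
  shows "toggled G (sym_diff S T) = sym_diff (toggled G S) (toggled G T)"
proof -
  have "closed_nbhd G v \<inter> sym_diff S T
      = sym_diff (closed_nbhd G v \<inter> S) (closed_nbhd G v \<inter> T)" for v
    by blast
  then show ?thesis using assms by (auto simp: toggled_def even_card_sym_diff)
qed

lemma finite_quiet_patterns:
  assumes "finite (verts G)"
  shows "finite (quiet_patterns G)"
  using assms by (simp add: quiet_patterns_def)

lemma finite_if_quiet:
  assumes "finite (verts G)" "R \<in> quiet_patterns G"
  shows "finite R"
  using assms finite_subset by (auto simp: quiet_patterns_def)

lemma empty_quiet: "{} \<in> quiet_patterns G"
  by (simp add: quiet_patterns_def toggled_def)

lemma sym_diff_quiet:
  assumes "finite (verts G)" "P \<in> quiet_patterns G" "Q \<in> quiet_patterns G"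
  shows "sym_diff P Q \<in> quiet_patterns G"
  using assms finite_if_quiet[OF assms(1)] toggled_sym_diff[of P Q G]
  by (auto simp: quiet_patterns_def)

lemma solutions_toggled_eq:
  assumes "finite (verts G)" "S \<subseteq> verts G"
  shows "solutions G (toggled G S) = sym_diff S ` quiet_patterns G"
proof
  have "finite S" using assms finite_subset by blast
  show "solutions G (toggled G S) \<subseteq> sym_diff S ` quiet_patterns G"
  proof
    fix T assume "T \<in> solutions G (toggled G S)"
    then have T: "T \<subseteq> verts G" "toggled G T = toggled G S" by (auto simp: solutions_def)
    then have "finite T" using assms(1) finite_subset by blast
    then have "sym_diff S T \<in> quiet_patterns G"
      using T \<open>S \<subseteq> verts G\<close> toggled_sym_diff[OF \<open>finite S\<close>] by (auto simp: quiet_patterns_def)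
    moreover have "T = sym_diff S (sym_diff S T)" by blast
    ultimately show "T \<in> sym_diff S ` quiet_patterns G" by (rule rev_image_eqI)
  qed
  show "sym_diff S ` quiet_patterns G \<subseteq> solutions G (toggled G S)"
  proof (rule image_subsetI)
    fix R assume "R \<in> quiet_patterns G"
    moreover from this have "toggled G (sym_diff S R) = toggled G S"
      using toggled_sym_diff[OF \<open>finite S\<close> finite_if_quiet[OF assms(1)]]
      by (simp add: quiet_patterns_def)
    ultimately show "sym_diff S R \<in> solutions G (toggled G S)"
      using \<open>S \<subseteq> verts G\<close> by (auto simp: solutions_def quiet_patterns_def)
  qed
qed

lemma solvable_configurations_eq:
  "{C. C \<subseteq> verts G \<and> solvable G C} = toggled G ` Pow (verts G)"
  by (auto simp: solvable_def solutions_def toggled_def)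

lemma le_most_clicks_iff:
  assumes "finite (verts G)"
  shows "n \<le> most_clicks G
    \<longleftrightarrow> (\<exists>S \<subseteq> verts G. \<forall>R \<in> quiet_patterns G. n \<le> card (sym_diff S R))"
proof -
  have "n \<le> min_clicks G (toggled G S) \<longleftrightarrow> (\<forall>R \<in> quiet_patterns G. n \<le> card (sym_diff S R))"
    if "S \<subseteq> verts G" for S
    using empty_quiet[of G] finite_quiet_patterns[OF assms]
    unfolding min_clicks_def solutions_toggled_eq[OF assms that] by (subst Min_ge_iff) auto
  then show ?thesis
    unfolding most_clicks_def solvable_configurations_eq
    using assms by (subst Max_ge_iff) auto
qed

lemma sum_card_solutions:
  assumes "finite (verts G)" "S \<subseteq> verts G"
  shows "2 * (\<Sum>R \<in> quiet_patterns G. card (sym_diff S R))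
    = card (quiet_patterns G)
      * (2 * card (S - \<Union>(quiet_patterns G)) + card (\<Union>(quiet_patterns G)))"
  using assms by (intro sum_card_sym_diff finite_quiet_patterns sym_diff_quiet)
    (auto intro: finite_subset finite_if_quiet)

lemma Union_quiet_subset: "\<Union>(quiet_patterns G) \<subseteq> verts G"
  by (auto simp: quiet_patterns_def)

lemma card_Diff_Union_quiet:
  assumes "finite (verts G)"
  shows "card (verts G - \<Union>(quiet_patterns G)) + card (\<Union>(quiet_patterns G)) = card (verts G)"
  using card_Int_Diff[OF assms, of "\<Union>(quiet_patterns G)"] Union_quiet_subset[of G]
  by (simp add: Int_absorb1)

lemma card_quiet_pos:
  assumes "finite (verts G)"
  shows "card (quiet_patterns G) > 0"
  using empty_quiet[of G] finite_quiet_patterns[OF assms] by (auto simp: card_gt_0_iff)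

theorem most_clicks_le_quiet_bound:
  assumes "finite (verts G)"
  shows "2 * most_clicks G + card (\<Union>(quiet_patterns G)) \<le> 2 * card (verts G)"
proof -
  let ?K = "quiet_patterns G"
  obtain S where S: "S \<subseteq> verts G" "\<And>R. R \<in> ?K \<Longrightarrow> most_clicks G \<le> card (sym_diff S R)"
    using le_most_clicks_iff[OF assms, of "most_clicks G"] by auto
  have "card ?K * most_clicks G \<le> (\<Sum>R\<in>?K. card (sym_diff S R))"
    using sum_bounded_below[of ?K "most_clicks G"] S(2) by simp
  then have "card ?K * (2 * most_clicks G) \<le> card ?K * (2 * card (S - \<Union>?K) + card (\<Union>?K))"
    using sum_card_solutions[OF assms S(1)] by linarith
  then have "2 * most_clicks G \<le> 2 * card (S - \<Union>?K) + card (\<Union>?K)"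
    using card_quiet_pos[OF assms] by simp
  moreover have "card (S - \<Union>?K) \<le> card (verts G - \<Union>?K)"
    using assms S(1) by (intro card_mono) auto
  ultimately show ?thesis using card_Diff_Union_quiet[OF assms] by linarith
qed

theorem most_clicks_eq_if_bisects_quiet:
  assumes "finite (verts G)" "S \<subseteq> verts G" "verts G - \<Union>(quiet_patterns G) \<subseteq> S"
    and "\<And>R. R \<in> quiet_patterns G \<Longrightarrow> bisects S R"
  shows "2 * most_clicks G + card (\<Union>(quiet_patterns G)) = 2 * card (verts G)"
proof -
  let ?K = "quiet_patterns G"
  have card_translate: "card (sym_diff S R) = card S" if "R \<in> ?K" for R
    using assms that finite_if_quiet[OF assms(1)] finite_subset
    by (intro card_sym_diff_bisects) auto
  then have "card S \<le> most_clicks G"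
    using assms(1,2) le_most_clicks_iff[of G "card S"] by (metis order_refl)
  moreover have "card ?K * (2 * card S) = card ?K * (2 * card (S - \<Union>?K) + card (\<Union>?K))"
    using sum_card_solutions[OF assms(1,2)] card_translate by (simp add: mult.left_commute)
  then have "2 * card S = 2 * card (S - \<Union>?K) + card (\<Union>?K)"
    using card_quiet_pos[OF assms(1)] by (metis mult_left_cancel not_gr_zero)
  moreover have "card (S - \<Union>?K) = card (verts G - \<Union>?K)"
    using assms(2,3) by (intro arg_cong[where f = card]) blast
  ultimately show ?thesis
    using most_clicks_le_quiet_bound[OF assms(1)] card_Diff_Union_quiet[OF assms(1)] by linarith
qed

subsection \<open>Graphs with a two-dimensional kernel\<close>

lemma inj_indicator_F2: "inj indicator_F2"
  by (rule injI) (simp add: indicator_F2_def fun_eq_iff set_eq_iff of_bool_eq_iff)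

lemma indicator_F2_sym_diff: "indicator_F2 (sym_diff A B) = indicator_F2 A + indicator_F2 B"
  by (auto simp: indicator_F2_def fun_eq_iff)

lemma indicator_F2_empty: "indicator_F2 {} = 0"
  by (simp add: indicator_F2_def fun_eq_iff)

lemma span_insert_F2:
  "module.span scale_F2 (insert b B)
    = module.span scale_F2 B \<union> (\<lambda>x. b + x) ` module.span scale_F2 B"
proof -
  interpret vector_space scale_F2 by (rule vector_space_F2)
  have "scale_F2 c b \<in> {0, b}" for c
    by (cases c) simp_all
  then have "span {b} \<subseteq> {0, b}" unfolding span_singleton by blast
  moreover have "{0, b} \<subseteq> span {b}" by (simp add: span_zero span_base)
  ultimately have "span {b} = {0, b}" by blast
  then have "span ({b} \<union> B) = {x + y | x y. x \<in> {0, b} \<and> y \<in> span B}"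
    unfolding span_Un by simp
  then show ?thesis by (auto simp: image_iff) (metis add_0)
qed

lemma quiet_patterns_eq_if_kernel_dim_2:
  assumes "kernel_dim G = 2" "finite (verts G)"
    and quiet: "P \<in> quiet_patterns G" "Q \<in> quiet_patterns G"
    and distinct: "P \<noteq> {}" "Q \<noteq> {}" "P \<noteq> Q"
  shows "quiet_patterns G = {{}, P, Q, sym_diff P Q}"
proof
  interpret vector_space scale_F2 by (rule vector_space_F2)
  let ?ind = "indicator_F2 :: 'a set \<Rightarrow> 'a \<Rightarrow> bit"
  have span_pair: "span {?ind P, ?ind Q} = ?ind ` {{}, P, Q, sym_diff P Q}"
    by (auto simp: span_insert_F2 indicator_F2_sym_diff indicator_F2_empty)
  have "?ind P \<noteq> 0" "?ind Q \<noteq> 0" "?ind P \<noteq> ?ind Q"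
    using distinct unfolding indicator_F2_empty[symmetric]
    by (simp_all only: inj_eq[OF inj_indicator_F2] not_False_eq_True)
  then have "?ind Q \<notin> span {}" "?ind P \<notin> span {?ind Q}"
    by (simp_all add: span_insert_F2)
  then have independent: "independent {?ind P, ?ind Q}"
    by (intro independent_insertI independent_empty)
  obtain B where B: "{?ind P, ?ind Q} \<subseteq> B" "B \<subseteq> ?ind ` quiet_patterns G"
      "independent B" "?ind ` quiet_patterns G \<subseteq> span B"
    using maximal_independent_subset_extend[OF _ independent, of "?ind ` quiet_patterns G"] quiet
    by (metis empty_subsetI image_eqI insert_subset)
  then have "card B = 2"
    using basis_card_eq_dim[of B "?ind ` quiet_patterns G"] \<open>kernel_dim G = 2\<close>
    by (simp add: kernel_dim_def quiet_patterns_def)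
  moreover have "card {?ind P, ?ind Q} = 2"
    using \<open>?ind P \<noteq> ?ind Q\<close> by simp
  ultimately have "B = {?ind P, ?ind Q}"
    using B(1) by (metis card.infinite card_subset_eq zero_neq_numeral)
  then have "?ind ` quiet_patterns G \<subseteq> ?ind ` {{}, P, Q, sym_diff P Q}"
    using B(4) span_pair by simp
  then show "quiet_patterns G \<subseteq> {{}, P, Q, sym_diff P Q}"
    by (simp only: inj_image_subset_iff[OF inj_indicator_F2])
  show "{{}, P, Q, sym_diff P Q} \<subseteq> quiet_patterns G"
    using quiet empty_quiet sym_diff_quiet[OF assms(2) quiet] by simp
qed

theorem most_clicks_eq_if_kernel_dim_2:
  assumes "kernel_dim G = 2" "finite (verts G)"
    and quiet: "P \<in> quiet_patterns G" "Q \<in> quiet_patterns G"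
    and distinct: "P \<noteq> {}" "Q \<noteq> {}" "P \<noteq> Q"
    and even: "even (card (P - Q))" "even (card (Q - P))" "even (card (P \<inter> Q))"
  shows "2 * most_clicks G + card (P \<union> Q) = 2 * card (verts G)"
proof -
  have quiet_patterns: "quiet_patterns G = {{}, P, Q, sym_diff P Q}"
    using quiet_patterns_eq_if_kernel_dim_2 assms by blast
  then have Union: "\<Union>(quiet_patterns G) = P \<union> Q" by auto
  have fin: "finite P" "finite Q" using quiet finite_if_quiet[OF assms(2)] by blast+
  let ?regions = "{P - Q, Q - P, P \<inter> Q}"
  have regions: "\<Union>?regions = P \<union> Q" by blast
  obtain S where S: "S \<subseteq> verts G" "verts G - (P \<union> Q) \<subseteq> S"
      "\<And>A. A \<in> ?regions \<Longrightarrow> bisects S A"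
  proof (rule obtain_bisecting_set[of "verts G" ?regions])
    show "\<Union>?regions \<subseteq> verts G" using Union_quiet_subset[of G] Union regions by simp
    show "pairwise disjnt ?regions" by (auto simp: pairwise_def disjnt_def)
  qed (use assms(2) even regions in auto)
  have "bisects S (P - Q \<union> P \<inter> Q)" "bisects S (Q - P \<union> P \<inter> Q)" "bisects S (sym_diff P Q)"
    using S(3) fin by (auto intro!: bisects_Un)
  moreover have "P - Q \<union> P \<inter> Q = P" "Q - P \<union> P \<inter> Q = Q" by blast+
  ultimately have "bisects S R" if "R \<in> quiet_patterns G" for R
    using that bisects_empty unfolding quiet_patterns by auto
  then show ?thesis
    using most_clicks_eq_if_bisects_quiet[OF assms(2) S(1)] S(2) unfolding Union by blast
qed

subsection \<open>Patterns on the grid\<close>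

text \<open>Predicates take coordinates from \<open>1\<close> to \<open>m\<close>, one more than those of \<open>grid_graph\<close>, so
  that they also describe the frame of cells just outside the grid; the cross around the vertex
  \<open>(i, j)\<close> has its centre at \<open>(i + 1, j + 1)\<close>.\<close>

definition grid_pattern :: "nat \<Rightarrow> (nat \<Rightarrow> nat \<Rightarrow> bool) \<Rightarrow> (nat \<times> nat) set" where
  "grid_pattern m f = {(i, j). i < m \<and> j < m \<and> f (Suc i) (Suc j)}"

definition vanishes_on_frame :: "nat \<Rightarrow> (nat \<Rightarrow> nat \<Rightarrow> bool) \<Rightarrow> bool" where
  "vanishes_on_frame m f \<longleftrightarrow>
    (\<forall>t. \<not> f 0 t \<and> \<not> f (Suc m) t \<and> \<not> f t 0 \<and> \<not> f t (Suc m))"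

lemma grid_pattern_Diff:
  "grid_pattern m f - grid_pattern m g = grid_pattern m (\<lambda>i j. f i j \<and> \<not> g i j)"
  by (auto simp: grid_pattern_def)

lemma grid_pattern_Int:
  "grid_pattern m f \<inter> grid_pattern m g = grid_pattern m (\<lambda>i j. f i j \<and> g i j)"
  by (auto simp: grid_pattern_def)

lemma grid_pattern_Un:
  "grid_pattern m f \<union> grid_pattern m g = grid_pattern m (\<lambda>i j. f i j \<or> g i j)"
  by (auto simp: grid_pattern_def)

definition cross_count :: "(nat \<Rightarrow> nat \<Rightarrow> bool) \<Rightarrow> nat \<Rightarrow> nat \<Rightarrow> nat" where
  "cross_count f i j = of_bool (f (i + 1) (j + 1)) + of_bool (f i (j + 1))
    + of_bool (f (i + 2) (j + 1)) + of_bool (f (i + 1) j) + of_bool (f (i + 1) (j + 2))"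

lemma cross_count_transpose: "cross_count (\<lambda>i j. f j i) i j = cross_count f j i"
  by (simp add: cross_count_def)

lemma verts_grid: "verts (grid_graph m) = {..<m} \<times> {..<m}"
  by (simp add: grid_graph_def Let_def)

lemma closed_nbhd_grid:
  assumes "i < m" "j < m"
  shows "closed_nbhd (grid_graph m) (i, j) =
    {(a, b). a < m \<and> b < m \<and>
       (a = i \<and> (b = j \<or> b = Suc j \<or> j = Suc b) \<or> b = j \<and> (a = Suc i \<or> i = Suc a))}"
  using assms by (auto simp: closed_nbhd_def grid_graph_def Let_def doubleton_eq_iff)

lemma card_closed_nbhd_grid_pattern:
  assumes frame: "vanishes_on_frame m f" and "i < m" "j < m"
  shows "card (closed_nbhd (grid_graph m) (i, j) \<inter> grid_pattern m f) = cross_count f i j"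
proof -
  let ?N = "closed_nbhd (grid_graph m) (i, j) \<inter> grid_pattern m f"
  let ?cross = "{(i + 1, j + 1), (i, j + 1), (i + 2, j + 1), (i + 1, j), (i + 1, j + 2)}"
  have "map_prod Suc Suc ` ?N = ?cross \<inter> {(x, y). f x y}"
  proof (intro equalityI subsetI)
    fix c assume c_in: "c \<in> ?cross \<inter> {(x, y). f x y}"
    obtain x y where c_eq: "c = (x, y)" by fastforce
    then have "f x y" using c_in by simp
    then have "x \<noteq> 0" "y \<noteq> 0" "x \<noteq> Suc m" "y \<noteq> Suc m"
      using frame unfolding vanishes_on_frame_def by metis+
    then obtain a b where "c = (Suc a, Suc b)" "a < m" "b < m"
      using c_in assms(2,3) c_eq by (cases x; cases y; auto)
    then show "c \<in> map_prod Suc Suc ` ?N"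
      using c_in assms(2,3)
      by (intro image_eqI[of _ _ "(a, b)"]) (auto simp: closed_nbhd_grid grid_pattern_def)
  qed (use assms(2,3) in \<open>auto simp: closed_nbhd_grid grid_pattern_def\<close>)
  moreover have "card (map_prod Suc Suc ` ?N) = card ?N"
    by (rule card_image) (auto intro: inj_onI)
  ultimately have "card ?N = (\<Sum>c \<in> ?cross. of_bool (case c of (x, y) \<Rightarrow> f x y))"
    by (simp only: sum_of_bool_eq finite.intros of_nat_id mem_Collect_eq)
  also have "\<dots> = cross_count f i j"
    by (simp add: cross_count_def del: sum_of_bool_eq)
  finally show ?thesis .
qed

lemma grid_pattern_quietI:
  assumes "vanishes_on_frame m f" "\<And>i j. even (cross_count f i j)"
  shows "grid_pattern m f \<in> quiet_patterns (grid_graph m)"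
  using assms(2) card_closed_nbhd_grid_pattern[OF assms(1)]
  by (auto simp: quiet_patterns_def toggled_def verts_grid grid_pattern_def)

lemma sum_periodic:
  fixes g :: "nat \<Rightarrow> 'a :: comm_semiring_1"
  assumes "\<And>i. g (i + p) = g i"
  shows "(\<Sum>i < k * p. g i) = of_nat k * (\<Sum>i<p. g i)"
proof -
  have shift: "g (n * p + i) = g i" for i n
  proof (induction n)
    case (Suc n)
    then show ?case using assms[of "n * p + i"] by (simp add: ac_simps)
  qed simp
  have "(\<Sum>i < k * p. g i) = (\<Sum>n<k. \<Sum>i = n * p..<n * p + p. g i)"
    by (rule sum.nat_group[symmetric])
  also have "\<dots> = (\<Sum>n<k. \<Sum>i<p. g i)"
  proof (rule sum.cong)
    fix n
    show "(\<Sum>i = n * p..<n * p + p. g i) = (\<Sum>i<p. g i)"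
      using sum.shift_bounds_nat_ivl[of g 0 "n * p" p]
      by (simp add: shift lessThan_atLeast0 add.commute[of _ "n * p"])
  qed simp
  finally show ?thesis by simp
qed

lemma card_grid_pattern_periodic:
  assumes "\<And>i j. f (i + p) j = f i j" "\<And>i j. f i (j + p) = f i j"
    and "\<And>t. \<not> f 0 t" "\<And>t. \<not> f t 0" and Suc_m: "Suc m = k * p"
  shows "card (grid_pattern m f) = k\<^sup>2 * (\<Sum>i<p. \<Sum>j<p. of_bool (f i j))"
proof -
  have "card (grid_pattern m f) = card (({..<m} \<times> {..<m}) \<inter> {(i, j). f (Suc i) (Suc j)})"
    by (rule arg_cong[where f = card]) (auto simp: grid_pattern_def)
  also have "\<dots> = (\<Sum>i<m. \<Sum>j<m. of_bool (f (Suc i) (Suc j)))"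
    by (simp add: sum.cartesian_product case_prod_unfold del: sum_of_bool_eq) simp
  also have "\<dots> = (\<Sum>i<Suc m. \<Sum>j<Suc m. of_bool (f i j))"
    unfolding sum.lessThan_Suc_shift using assms(3,4) by simp
  also have "\<dots> = (\<Sum>i<k * p. k * (\<Sum>j<p. of_bool (f i j)))"
    unfolding Suc_m using assms(2) by (subst sum_periodic) simp_all
  also have "\<dots> = k * (\<Sum>i<p. k * (\<Sum>j<p. of_bool (f i j)))"
    using assms(1) by (subst sum_periodic) simp_all
  finally show ?thesis
    by (simp add: power2_eq_square mult.assoc del: sum_of_bool_eq flip: sum_distrib_left)
qed

definition striped :: "nat \<Rightarrow> nat \<Rightarrow> bool" where
  "striped i j \<longleftrightarrow> \<not> 3 dvd i \<and> odd j"

definition stripes :: "nat \<Rightarrow> (nat \<times> nat) set" where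
  "stripes m = grid_pattern m striped"

definition transposed_stripes :: "nat \<Rightarrow> (nat \<times> nat) set" where
  "transposed_stripes m = grid_pattern m (\<lambda>i j. striped j i)"

lemma stripes_quiet:
  assumes "6 dvd Suc m"
  shows "stripes m \<in> quiet_patterns (grid_graph m)"
    and "transposed_stripes m \<in> quiet_patterns (grid_graph m)"
proof -
  have "3 dvd Suc m" "even (Suc m)" using assms by presburger+
  then have frame: "vanishes_on_frame m striped" by (simp add: vanishes_on_frame_def striped_def)
  then have frame_transpose: "vanishes_on_frame m (\<lambda>i j. striped j i)"
    by (simp add: vanishes_on_frame_def)
  have even: "even (cross_count striped i j)" for i j
    unfolding cross_count_def striped_def of_bool_def by presburger
  show "stripes m \<in> quiet_patterns (grid_graph m)"
    unfolding stripes_def by (rule grid_pattern_quietI[OF frame even])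
  show "transposed_stripes m \<in> quiet_patterns (grid_graph m)"
    unfolding transposed_stripes_def
    by (rule grid_pattern_quietI[OF frame_transpose]) (subst cross_count_transpose, rule even)
qed

lemma card_stripes:
  assumes "Suc m = k * 6"
  shows "card (stripes m - transposed_stripes m) = 8 * k\<^sup>2"
    and "card (transposed_stripes m - stripes m) = 8 * k\<^sup>2"
    and "card (stripes m \<inter> transposed_stripes m) = 4 * k\<^sup>2"
    and "card (stripes m \<union> transposed_stripes m) = 20 * k\<^sup>2"
proof -
  have period: "striped (i + 6) j = striped i j" "striped i (j + 6) = striped i j" for i j
    unfolding striped_def by presburger+
  have frame: "\<not> striped 0 t" "\<not> striped t 0" for t by (simp_all add: striped_def)
  have count: "card (grid_pattern m (\<lambda>i j. conn (striped i j) (striped j i)))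
      = k\<^sup>2 * (\<Sum>i<6. \<Sum>j<6. of_bool (conn (striped i j) (striped j i)))"
    if "\<not> conn False False" for conn
    by (rule card_grid_pattern_periodic) (use that in \<open>simp_all add: period frame assms\<close>)
  note stripes_simps = stripes_def transposed_stripes_def grid_pattern_Diff grid_pattern_Int
    grid_pattern_Un striped_def lessThan_nat_numeral lessThan_Suc
  show "card (stripes m - transposed_stripes m) = 8 * k\<^sup>2"
    using count[of "\<lambda>a b. a \<and> \<not> b"] by (simp add: stripes_simps del: sum_of_bool_eq)
  show "card (transposed_stripes m - stripes m) = 8 * k\<^sup>2"
    using count[of "\<lambda>a b. b \<and> \<not> a"] by (simp add: stripes_simps del: sum_of_bool_eq)
  show "card (stripes m \<inter> transposed_stripes m) = 4 * k\<^sup>2"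
    using count[of "\<lambda>a b. a \<and> b"] by (simp add: stripes_simps del: sum_of_bool_eq)
  show "card (stripes m \<union> transposed_stripes m) = 20 * k\<^sup>2"
    using count[of "\<lambda>a b. a \<or> b"] by (simp add: stripes_simps del: sum_of_bool_eq)
qed

theorem theorem3:
  fixes k :: nat
  assumes "k > 0"
  shows "int (most_clicks (grid_graph (6 * k - 1))) \<le> 26 * (int k)\<^sup>2 - 12 * int k + 1 \<and>
    (d_grid (6 * k - 1) = 2 \<longrightarrow>
      int (most_clicks (grid_graph (6 * k - 1))) = 26 * (int k)\<^sup>2 - 12 * int k + 1)"
proof -
  let ?G = "grid_graph (6 * k - 1)" and ?P = "stripes (6 * k - 1)"
  let ?Q = "transposed_stripes (6 * k - 1)"
  have Suc_m: "Suc (6 * k - 1) = k * 6" using assms by simp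
  have fin: "finite (verts ?G)" by (simp add: verts_grid)
  have "6 dvd Suc (6 * k - 1)" unfolding Suc_m by simp
  note quiet = stripes_quiet[OF this]
  have "int (card (verts ?G)) = (6 * int k - 1)\<^sup>2"
    using assms by (simp add: verts_grid power2_eq_square of_nat_diff)
  then have bound: "int (card (verts ?G)) - 10 * (int k)\<^sup>2 = 26 * (int k)\<^sup>2 - 12 * int k + 1"
    by (simp add: power2_eq_square algebra_simps)
  have "card (?P \<union> ?Q) \<le> card (\<Union>(quiet_patterns ?G))"
    using quiet finite_subset[OF Union_quiet_subset fin] by (intro card_mono) auto
  then have "2 * most_clicks ?G + 20 * k\<^sup>2 \<le> 2 * card (verts ?G)"
    using most_clicks_le_quiet_bound[OF fin] card_stripes(4)[OF Suc_m] by linarith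
  moreover have "2 * most_clicks ?G + 20 * k\<^sup>2 = 2 * card (verts ?G)"
    if "d_grid (6 * k - 1) = 2"
  proof -
    have "card (?P - ?Q) > 0" "card (?Q - ?P) > 0" using card_stripes[OF Suc_m] assms by simp_all
    then have "?P \<noteq> {}" "?Q \<noteq> {}" "?P \<noteq> ?Q" by auto
    then show ?thesis
      using most_clicks_eq_if_kernel_dim_2[OF that[unfolded d_grid_def] fin quiet]
        card_stripes[OF Suc_m] by simp
  qed
  ultimately show ?thesis using bound by (auto simp flip: of_nat_power)
qed

end
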